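(* Let $m\ge0$ be an integer and $T_m$ the Chebyshev polynomial. Let $z,\theta,p\in\mathbb{C}$ with $\left|\frac{1-z}2\right|<1$ and $\left|\arg\left(1-\theta\frac{1-z}2\right)\right|<\pi$. Then $$\left(1-\theta\frac{1-z}2\right)^pT_m(z)=\sum_{n=0}^\infty v_n\left(\frac{1-z}2\right)^n,$$ where $v_0=1$, $v_1=-2m^2-p\theta$, $$v_2=\frac12\theta^2p(p-1)+2m^2\theta p+\frac{4m^2(m+1)(m-1)}6,$$ and for $n\ge2$, $$v_{n+1}=\frac{\mu_n}{(n+1)(n+\frac12)}v_n-\theta\frac{\zeta_n}{(n+1)(n+\frac12)}v_{n-1}+\theta^2\frac{\sigma_n}{(n+1)(n+\frac12)}v_{n-2},$$ with \begin{align*} \mu_n&=(n-m)(n+m)+\theta\left[2n^2-2n\left(p+\tfrac12\right)-\tfrac12p\right],\\ \zeta_n&=2n^2-2(p+2)n+p+2(-m-1)(m-1)+\theta(n-p-1)\left(n-p+\tfrac12-2\right),\\ \sigma_n&=(n-m-p-2)(n+m-p-2). \end{align*}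
   Context: $T_m$ is the polynomial with $T_m(\cos\varphi)=\cos(m\varphi)$; it satisfies $T_m(z)=F\left(-m,m;\frac12;\frac{1-z}2\right)$, where $F(a,b;c;x)=\sum_{n=0}^\infty\frac{(a)_n(b)_n}{(c)_n}\frac{x^n}{n!}$, $(a)_0=1$, $(a)_n=a(a+1)\cdots(a+n-1)$. The complex power is the principal branch.
   Formalization: The series can diverge when |θ(1-z)/2|>1 (m=0, p=-1, θ=2, z=14/5), so convergence to the left side is claimed only for |θ(1-z)/2|<1 or p a natural number; elsewhere equality is claimed whenever the series converges. 1-θ(1-z)/2≠0 is explicit. *)

theory Defs
  imports
    "HOL-Complex_Analysis.Complex_Analysis"
    "HOL-Computational_Algebra.Computational_Algebra"
begin

definition chebyshev_T :: "nat \<Rightarrow> complex poly" where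
  "chebyshev_T m = (THE P. \<forall>\<phi>::real. poly P (of_real (cos \<phi>)) = of_real (cos (real m * \<phi>)))"

lemma chebyshev_T_exists:
  "\<exists>P :: complex poly. \<forall>\<phi>::real. poly P (of_real (cos \<phi>)) = of_real (cos (real m * \<phi>))"
proof (induction m rule: less_induct)
  case (less m)
  consider "m = 0" | "m = 1" | k where "m = Suc (Suc k)"
    by (metis One_nat_def not0_implies_Suc)
  then show ?case
  proof cases
    case 1
    then show ?thesis by (intro exI[of _ 1]) simp
  next
    case 2
    then show ?thesis by (intro exI[of _ "[:0, 1:]"]) simp
  next
    case 3
    obtain P Q :: "complex poly"
      where P: "\<forall>\<phi>::real. poly P (of_real (cos \<phi>)) = of_real (cos (real (Suc k) * \<phi>))"
        and Q: "\<forall>\<phi>::real. poly Q (of_real (cos \<phi>)) = of_real (cos (real k * \<phi>))"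
      using less.IH[of "Suc k"] less.IH[of k] 3 by auto
    have trig: "cos (real m * \<phi>) = 2 * cos \<phi> * cos (real (Suc k) * \<phi>) - cos (real k * \<phi>)"
      for \<phi> :: real
    proof -
      have "real m * \<phi> = real (Suc k) * \<phi> + \<phi>" "real k * \<phi> = real (Suc k) * \<phi> - \<phi>"
        using 3 by (simp_all add: algebra_simps)
      then show ?thesis
        by (simp only: cos_add cos_diff) simp
    qed
    have "\<forall>\<phi>::real. poly ([:0, 2:] * P - Q) (of_real (cos \<phi>)) = of_real (cos (real m * \<phi>))"
      unfolding trig using P Q by simp
    then show ?thesis by blast
  qed
qed

lemma chebyshev_T_unique:
  fixes P Q :: "complex poly"
  assumes "\<forall>\<phi>::real. poly P (of_real (cos \<phi>)) = of_real (cos (real m * \<phi>))"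
    and "\<forall>\<phi>::real. poly Q (of_real (cos \<phi>)) = of_real (cos (real m * \<phi>))"
  shows "P = Q"
proof (rule ccontr)
  assume "P \<noteq> Q"
  then have "finite {x. poly (P - Q) x = 0}"
    by (intro poly_roots_finite) simp
  moreover have "(of_real :: real \<Rightarrow> complex) ` {-1..1} \<subseteq> {x. poly (P - Q) x = 0}"
  proof (clarify)
    fix x :: real assume "x \<in> {-1..1}"
    then have "x = cos (arccos x)" by simp
    then show "poly (P - Q) (of_real x) = 0"
      using assms by (metis poly_diff right_minus_eq)
  qed
  ultimately have "finite ((of_real :: real \<Rightarrow> complex) ` {-1..1})"
    using finite_subset by blast
  then have "finite {-1..1::real}"
    by (rule finite_imageD) (simp add: inj_on_def)
  then show False
    using infinite_Icc[of "-1::real" 1] by simp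
qed

lemma poly_chebyshev_T_cos:
  "poly (chebyshev_T m) (of_real (cos \<phi>)) = of_real (cos (real m * \<phi>))"
proof -
  have "\<exists>!P :: complex poly. \<forall>\<phi>::real. poly P (of_real (cos \<phi>)) = of_real (cos (real m * \<phi>))"
    using chebyshev_T_exists[of m] chebyshev_T_unique[of _ m] by blast
  from theI'[OF this] show ?thesis
    unfolding chebyshev_T_def by blast
qed

definition rec_mu :: "nat \<Rightarrow> complex \<Rightarrow> complex \<Rightarrow> nat \<Rightarrow> complex" where
  "rec_mu m \<theta> p n =
     (of_nat n - of_nat m) * (of_nat n + of_nat m)
     + \<theta> * (2 * (of_nat n)^2 - 2 * of_nat n * (p + 1/2) - 1/2 * p)"

definition rec_zeta :: "nat \<Rightarrow> complex \<Rightarrow> complex \<Rightarrow> nat \<Rightarrow> complex" where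
  "rec_zeta m \<theta> p n =
     2 * (of_nat n)^2 - 2 * (p + 2) * of_nat n + p + 2 * (- of_nat m - 1) * (of_nat m - 1)
     + \<theta> * (of_nat n - p - 1) * (of_nat n - p + 1/2 - 2)"

definition rec_sigma :: "nat \<Rightarrow> complex \<Rightarrow> nat \<Rightarrow> complex" where
  "rec_sigma m p n = (of_nat n - of_nat m - p - 2) * (of_nat n + of_nat m - p - 2)"

(* If the norm of \<theta> * ((1 - z)/2) is at least 1, the series with these recurrence coefficients
   can diverge although Arg (1 - \<theta> * ((1 - z)/2)) = 0: for m = 0, p = -1, \<theta> = 2, z = 14/5
   it is the sum of (-9/5)^n.  At such points the theorem asserts the expansion whenever the
   series converges.  It also has 1 - \<theta> * ((1 - z)/2) \<noteq> 0 as a hypothesis, because Arg 0 = 0. *)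

end

theory Submission
  imports Defs
begin

text \<open>
  Put \<open>x = (1 - z) / 2\<close>, so that the function to expand is
  \<open>f(x) = (1 - \<theta> x)\<^sup>p T\<^sub>m(1 - 2 x)\<close>, and let \<open>F\<close> be its Taylor series at the origin.

  The polynomial \<open>Y(x) = T\<^sub>m(1 - 2 x)\<close> satisfies the hypergeometric equation
  \<open>x (1 - x) Y'' + (1/2 - x) Y' + m\<^sup>2 Y = 0\<close>, which is Chebyshev's equation after the substitution
  (\<open>chebyshev_T_ODE\<close>, \<open>chebyshev_shifted_ODE\<close>), and the binomial factor satisfies
  \<open>(1 - \<theta> x) A' = - p \<theta> A\<close>.  Eliminating \<open>A\<close> and \<open>Y\<close> from these in favour of their product gives a
  second order equation for \<open>F = A Y\<close> whose leading coefficient \<open>x (1 - x) (1 - \<theta> x)\<^sup>2\<close> contains the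
  powers from \<open>x\<close> to \<open>x\<^sup>4\<close> (\<open>twisted_ODE\<close>).  Comparing coefficients therefore links four consecutive
  coefficients of \<open>F\<close>, and the relation is the recurrence of the theorem (\<open>twisted_recurrence\<close>).  Its
  instances of lowest index yield \<open>v\<^sub>1\<close> and \<open>v\<^sub>2\<close>, so \<open>v\<close> is the coefficient sequence of \<open>F\<close>.

  What remains is to sum \<open>F\<close> at the given point.  For \<open>\<bar>\<theta> x\<bar> < 1\<close> the function \<open>f\<close> is holomorphic on a
  disc around the origin that contains \<open>x\<close>, and for \<open>p \<in> \<nat>\<close> it agrees near the origin with a polynomial.
  In general the series may converge at \<open>x\<close> although \<open>\<bar>\<theta> x\<bar> \<ge> 1\<close>: the point \<open>x\<close> can lie on the circle of
  convergence, or a zero of \<open>T\<^sub>m(1 - 2 x)\<close> can cancel the pole at \<open>1 / \<theta>\<close> for \<open>p = -1\<close>.  Then the sum and \<open>f\<close> agree on the segment from the origin to \<open>x\<close>, endpoint excluded, by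
  analytic continuation inside the slit disc, and Abel's limit theorem carries the
  equality to \<open>x\<close> itself (\<open>suminf_twisted_chebyshev\<close>).
\<close>

section \<open>Abel's limit theorem\<close>

text \<open>
  Summation by parts: \<open>a\<^sub>n = e\<^sub>n - e\<^sub>n\<^sub>-\<^sub>1\<close> for the negated tails \<open>e\<^sub>n\<close>.  Since these tend to zero, the factor
  \<open>1 - r\<close> outweighs the growth of the sum on the right as \<open>r\<close> tends to \<open>1\<close>.
\<close>

lemma Abel_summation_remainder:
  fixes a :: "nat \<Rightarrow> complex" and r :: complex
  assumes a: "a sums S" and r: "norm r < 1"
  defines "e \<equiv> \<lambda>n. (\<Sum>k\<le>n. a k) - S"
  shows "summable (\<lambda>n. norm (e n * r ^ n))"
    and "(\<Sum>n. a n * r ^ n) - S = (1 - r) * (\<Sum>n. e n * r ^ n)"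
proof -
  have e0: "e \<longlonglongrightarrow> 0"
    using a unfolding e_def sums_def_le by (simp add: LIM_zero)
  then have "Bseq e" by (intro convergent_imp_Bseq convergentI)
  then obtain K where K: "\<And>n. norm (e n) \<le> K" by (auto simp: Bseq_def)
  show sn: "summable (\<lambda>n. norm (e n * r ^ n))"
  proof (rule summable_comparison_test')
    show "summable (\<lambda>n. K * norm r ^ n)"
      using r by (intro summable_mult summable_geometric) simp
    show "norm (norm (e n * r ^ n)) \<le> K * norm r ^ n" for n
      using K[of n] by (simp add: norm_mult norm_power mult_right_mono)
  qed
  then have s: "summable (\<lambda>n. e n * r ^ n)" by (rule summable_norm_cancel)
  have "(\<lambda>n. a n * r ^ n) sums (S + (\<Sum>n. e n * r ^ n) - r * (\<Sum>n. e n * r ^ n))"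
  proof -
    have "(\<lambda>n. e (Suc n) * r ^ Suc n) sums ((\<Sum>n. e n * r ^ n) - e 0)"
      using summable_sums[OF s] by (subst sums_Suc_iff) simp
    from sums_diff[OF this sums_mult[OF summable_sums[OF s], of r]]
    have "(\<lambda>n. a (Suc n) * r ^ Suc n) sums ((\<Sum>n. e n * r ^ n) - e 0 - r * (\<Sum>n. e n * r ^ n))"
      by (simp add: e_def algebra_simps)
    then show ?thesis
      by (subst (asm) sums_Suc_iff) (simp add: e_def algebra_simps)
  qed
  then show "(\<Sum>n. a n * r ^ n) - S = (1 - r) * (\<Sum>n. e n * r ^ n)"
    by (simp add: sums_iff algebra_simps)
qed

text \<open>
  The first \<open>N\<close> terms of the remainder sum are bounded and get lost in the factor \<open>1 - r\<close>; the others have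
  coefficients below \<open>\<epsilon> / 2\<close>, so that a geometric series dominates them and cancels this factor.
\<close>

theorem Abel_limit:
  fixes a :: "nat \<Rightarrow> complex"
  assumes a: "a sums S"
  shows "((\<lambda>r. \<Sum>n. a n * of_real r ^ n) \<longlongrightarrow> S) (at_left 1)"
proof (rule tendstoI)
  fix \<epsilon> :: real assume \<epsilon>: "\<epsilon> > 0"
  define e where "e = (\<lambda>n. (\<Sum>k\<le>n. a k) - S)"
  have "e \<longlonglongrightarrow> 0"
    using a unfolding e_def sums_def_le by (simp add: LIM_zero)
  then obtain N where N: "\<And>n. n \<ge> N \<Longrightarrow> norm (e n) < \<epsilon> / 2"
    using LIMSEQ_D[of e 0 "\<epsilon> / 2"] \<epsilon> by auto
  define M where "M = (\<Sum>n<N. norm (e n))"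
  have "((\<lambda>r::real. (1 - r) * M) \<longlongrightarrow> (1 - 1) * M) (at_left 1)"
    by (intro tendsto_intros)
  then have small: "eventually (\<lambda>r. (1 - r) * M < \<epsilon> / 2) (at_left 1)"
    using \<epsilon> by (intro order_tendstoD) auto
  have pos: "eventually (\<lambda>r::real. 0 < r \<and> r < 1) (at_left 1)"
    using eventually_at_left_real[of 0 1] by simp
  show "eventually (\<lambda>r. dist (\<Sum>n. a n * of_real r ^ n) S < \<epsilon>) (at_left 1)"
    using small pos
  proof eventually_elim
    case (elim r)
    then have r: "norm (of_real r :: complex) < 1" by simp
    have rem: "summable (\<lambda>n. norm (e n * of_real r ^ n))"
      "(\<Sum>n. a n * of_real r ^ n) - S = (1 - of_real r) * (\<Sum>n. e n * of_real r ^ n)"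
      using Abel_summation_remainder[OF a r] by (simp_all only: e_def)
    have nrm: "norm (e n * of_real r ^ n) = norm (e n) * r ^ n" for n
      using elim by (simp add: norm_mult norm_power)
    have sn: "summable (\<lambda>n. norm (e n) * r ^ n)"
      using rem(1) unfolding nrm .
    have g: "(\<lambda>n. \<epsilon> / 2 * r ^ n) sums (\<epsilon> / 2 * (1 / (1 - r)))"
      using elim by (intro sums_mult geometric_sums) simp
    have hd: "(\<lambda>n. if n \<in> {..<N} then norm (e n) else 0) sums M"
      unfolding M_def by (rule sums_If_finite_set) simp
    have "norm (\<Sum>n. e n * of_real r ^ n) \<le> (\<Sum>n. norm (e n) * r ^ n)"
      using summable_norm[OF rem(1)] unfolding nrm .
    also have "\<dots> \<le> M + \<epsilon> / 2 * (1 / (1 - r))"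
    proof (rule sums_le[OF _ summable_sums[OF sn] sums_add[OF hd g]])
      fix n
      have "r ^ n \<le> 1" using elim by (intro power_le_one) auto
      then have "norm (e n) * r ^ n \<le> norm (e n)" by (simp add: mult_left_le)
      moreover have "norm (e n) * r ^ n \<le> \<epsilon> / 2 * r ^ n" if "n \<ge> N"
        using N[OF that] elim by (intro mult_right_mono) auto
      moreover have "\<epsilon> / 2 * r ^ n \<ge> 0" using \<epsilon> elim by simp
      ultimately show "norm (e n) * r ^ n \<le> (if n \<in> {..<N} then norm (e n) else 0) + \<epsilon> / 2 * r ^ n"
        by (auto simp: not_less)
    qed
    finally have "(1 - r) * norm (\<Sum>n. e n * of_real r ^ n) \<le> (1 - r) * (M + \<epsilon> / 2 * (1 / (1 - r)))"
      using elim by (intro mult_left_mono) auto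
    also have "\<dots> = (1 - r) * M + \<epsilon> / 2" using elim by (simp add: field_simps)
    also have "\<dots> < \<epsilon>" using elim by simp
    finally have "(1 - r) * norm (\<Sum>n. e n * of_real r ^ n) < \<epsilon>" .
    moreover have "norm (1 - of_real r :: complex) = 1 - r"
      using elim by (metis abs_of_pos diff_gt_0_iff_gt norm_of_real of_real_1 of_real_diff)
    ultimately show ?case
      unfolding dist_norm rem(2) norm_mult by simp
  qed
qed

section \<open>Chebyshev's differential equation\<close>

text \<open>
  Both sides are entire in \<open>w\<close> and agree on the real line.  With complex arguments every point is a
  cosine, so identities in \<open>cos w\<close> are identities of polynomials.
\<close>

lemma poly_chebyshev_T_cos_complex:
  "poly (chebyshev_T m) (cos w) = cos (of_nat m * w)" for w :: complex
proof -
  have lim: "(0::complex) islimpt \<real>"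
    unfolding islimpt_approachable
  proof (intro allI impI)
    fix \<epsilon> :: real assume "\<epsilon> > 0"
    then show "\<exists>x'\<in>\<real>. x' \<noteq> (0::complex) \<and> dist x' 0 < \<epsilon>"
      by (intro bexI[of _ "of_real (\<epsilon> / 2)"]) (auto simp: norm_divide)
  qed
  have "poly (chebyshev_T m) (cos w) - cos (of_nat m * w) = 0"
  proof (rule analytic_continuation[of "\<lambda>w. poly (chebyshev_T m) (cos w) - cos (of_nat m * w)" UNIV \<real> 0 w])
    show "(\<lambda>w. poly (chebyshev_T m) (cos w) - cos (of_nat m * w)) holomorphic_on UNIV"
      by (intro holomorphic_intros)
    show "poly (chebyshev_T m) (cos z) - cos (of_nat m * z) = 0" if "z \<in> \<real>" for z :: complex
    proof -
      from that obtain x where x: "z = of_real x" by (auto elim: Reals_cases)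
      show ?thesis
        using poly_chebyshev_T_cos[of m x] by (simp add: x flip: cos_of_real)
    qed
  qed (use lim in auto)
  then show ?thesis by simp
qed

lemma chebyshev_T_at_1: "poly (chebyshev_T m) 1 = 1"
  using poly_chebyshev_T_cos[of m 0] by simp

text \<open>
  Differentiate \<open>T\<^sub>m(cos w) = cos (m w)\<close> twice, then take \<open>w\<close> with \<open>cos w = z\<close>.
\<close>

lemma chebyshev_T_ODE:
  fixes m :: nat
  defines "T \<equiv> chebyshev_T m"
  shows "(1 - z\<^sup>2) * poly (pderiv (pderiv T)) z - z * poly (pderiv T) z + (of_nat m)\<^sup>2 * poly T z = 0"
proof -
  have T: "poly T (cos w) = cos (of_nat m * w)" for w
    unfolding T_def by (rule poly_chebyshev_T_cos_complex)
  have D1: "poly (pderiv T) (cos w) * sin w = of_nat m * sin (of_nat m * w)" for w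
  proof -
    have "((\<lambda>w. poly T (cos w)) has_field_derivative poly (pderiv T) (cos w) * - sin w) (at w)"
      by (rule DERIV_chain2[OF poly_DERIV]) (auto intro!: derivative_eq_intros)
    moreover have "((\<lambda>w. poly T (cos w)) has_field_derivative - sin (of_nat m * w) * of_nat m) (at w)"
      unfolding T by (auto intro!: derivative_eq_intros)
    ultimately show ?thesis
      using DERIV_unique by fastforce
  qed
  have D2: "poly (pderiv T) (cos w) * cos w - poly (pderiv (pderiv T)) (cos w) * (sin w)\<^sup>2
            = (of_nat m)\<^sup>2 * cos (of_nat m * w)" for w
  proof -
    have "((\<lambda>w. poly (pderiv T) (cos w)) has_field_derivative poly (pderiv (pderiv T)) (cos w) * - sin w) (at w)"
      by (rule DERIV_chain2[OF poly_DERIV]) (auto intro!: derivative_eq_intros)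
    from DERIV_mult[OF this DERIV_sin[of w]]
    have "((\<lambda>w. poly (pderiv T) (cos w) * sin w) has_field_derivative
      poly (pderiv (pderiv T)) (cos w) * - sin w * sin w + cos w * poly (pderiv T) (cos w)) (at w)" .
    moreover have "((\<lambda>w. poly (pderiv T) (cos w) * sin w) has_field_derivative
       of_nat m * (cos (of_nat m * w) * of_nat m)) (at w)"
      unfolding D1 by (auto intro!: derivative_eq_intros)
    ultimately have "poly (pderiv (pderiv T)) (cos w) * - sin w * sin w + cos w * poly (pderiv T) (cos w)
        = of_nat m * (cos (of_nat m * w) * of_nat m)"
      by (rule DERIV_unique)
    then show ?thesis by (simp add: power2_eq_square algebra_simps)
  qed
  have z: "z = cos (Arccos z)" by simp
  show ?thesis
    using D2[of "Arccos z"] T[of "Arccos z"] sin_squared_eq[of "Arccos z"] z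
    by (simp add: algebra_simps)
qed

section \<open>The differential equation of the product\<close>

definition chebyshev_shifted :: "nat \<Rightarrow> complex fps" where
  "chebyshev_shifted m = fps_of_poly (pcompose (chebyshev_T m) [:1, -2:])"

text \<open>
  This is twice the hypergeometric equation of \<open>F(-m, m; 1/2; x)\<close>; doubling removes the fraction \<open>1/2\<close>,
  which would otherwise have to be carried along as a constant power series.
\<close>

lemma chebyshev_shifted_ODE:
  fixes m :: nat
  defines "Y \<equiv> chebyshev_shifted m"
  shows "2 * fps_X * (1 - fps_X) * fps_deriv (fps_deriv Y) + (1 - 2 * fps_X) * fps_deriv Y
           + 2 * fps_const ((of_nat m)\<^sup>2) * Y = 0"
proof -
  define T where "T = chebyshev_T m"
  define P where "P = pcompose T [:1, -2:]"
  define Q where "Q = [:0, 2:] * [:1, -1:] * pderiv (pderiv P) + [:1, -2:] * pderiv P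
      + smult (2 * (of_nat m)\<^sup>2) P"
  have "poly Q x = 0" for x
  proof -
    have "poly Q x = 2 * ((1 - (1 - 2 * x)\<^sup>2) * poly (pderiv (pderiv T)) (1 - 2 * x)
        - (1 - 2 * x) * poly (pderiv T) (1 - 2 * x) + (of_nat m)\<^sup>2 * poly T (1 - 2 * x))"
      by (simp add: Q_def P_def pderiv_pcompose poly_pcompose pderiv_mult pderiv_pCons
          pderiv_minus pderiv_smult power2_eq_square algebra_simps)
    then show ?thesis
      using chebyshev_T_ODE[of "1 - 2 * x" m] by (simp add: T_def)
  qed
  then have "Q = 0" using poly_all_0_iff_0 by blast
  then have "fps_of_poly Q = 0" by simp
  moreover have "fps_of_poly [:0, 2 :: complex:] = 2 * fps_X" "fps_of_poly [:1, -1 :: complex:] = 1 - fps_X"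
    "fps_of_poly [:1, -2 :: complex:] = 1 - 2 * fps_X"
    by (simp_all add: fps_of_poly_pCons numeral_fps_const mult.commute)
  ultimately show ?thesis
    unfolding Q_def Y_def chebyshev_shifted_def P_def T_def
    by (simp only: fps_of_poly_add fps_of_poly_mult fps_of_poly_smult fps_of_poly_pderiv
        numeral_fps_const fps_const_mult mult.assoc)
qed

definition binomial_scaled :: "complex \<Rightarrow> complex \<Rightarrow> complex fps" where
  "binomial_scaled \<theta> p = Abs_fps (\<lambda>n. (p gchoose n) * (- \<theta>) ^ n)"

lemma binomial_scaled_ODE:
  "(1 - fps_const \<theta> * fps_X) * fps_deriv (binomial_scaled \<theta> p)
     = - (fps_const (p * \<theta>) * binomial_scaled \<theta> p)"
proof (rule fps_ext)
  fix n
  have rec: "of_nat (Suc n) * (p gchoose Suc n) = (p - of_nat n) * (p gchoose n)"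
    by (metis gbinomial_absorb_comp gbinomial_absorption)
  show "((1 - fps_const \<theta> * fps_X) * fps_deriv (binomial_scaled \<theta> p)) $ n
      = (- (fps_const (p * \<theta>) * binomial_scaled \<theta> p)) $ n"
  proof (cases n)
    case 0
    then show ?thesis by (simp add: binomial_scaled_def algebra_simps)
  next
    case (Suc k)
    have "of_nat (Suc n) * ((p gchoose Suc n) * (- \<theta>) ^ Suc n)
        = (p - of_nat n) * (p gchoose n) * (- \<theta>) ^ Suc n"
      using rec by (simp only: mult.assoc[symmetric])
    then show ?thesis
      using Suc
      by (simp add: binomial_scaled_def algebra_simps mult.assoc)
  qed
qed

text \<open>
  With \<open>u = 1 - \<theta> X\<close>, the equation for \<open>A\<close> expresses \<open>u A Y'\<close> through \<open>F\<close> and \<open>F'\<close>, and its derivative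
  expresses \<open>u\<^sup>2 A Y''\<close> through \<open>F\<close>, \<open>F'\<close> and \<open>F''\<close>.  Multiplying the equation for \<open>Y\<close> by \<open>u\<^sup>2 A\<close> and
  substituting both expressions leaves an equation for \<open>F\<close> alone.
\<close>

lemma twisted_ODE:
  fixes A Y :: "complex fps"
  assumes A: "(1 - fps_const \<theta> * fps_X) * fps_deriv A = - (fps_const (p * \<theta>) * A)"
    and Y: "2 * fps_X * (1 - fps_X) * fps_deriv (fps_deriv Y) + (1 - 2 * fps_X) * fps_deriv Y
              + 2 * fps_const M * Y = 0"
  defines "F \<equiv> A * Y" and "u \<equiv> 1 - fps_const \<theta> * fps_X"
  shows "2 * fps_X * (1 - fps_X) * (u\<^sup>2 * fps_deriv (fps_deriv F)
             + 2 * fps_const (p * \<theta>) * u * fps_deriv F + fps_const (p * (p + 1) * \<theta>\<^sup>2) * F)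
         + (1 - 2 * fps_X) * (u\<^sup>2 * fps_deriv F + fps_const (p * \<theta>) * u * F)
         + 2 * fps_const M * u\<^sup>2 * F = 0"
proof -
  \<comment> \<open>Opaque names keep the constant series as indeterminates for the ring reasoning.\<close>
  define c where "c = fps_const \<theta>"
  define q where "q = fps_const p"
  have pq: "fps_const (p * \<theta>) = q * c" "fps_const (p * (p + 1) * \<theta>\<^sup>2) = q * (q + 1) * c\<^sup>2"
    by (simp_all add: q_def c_def fps_const_power flip: fps_const_mult fps_const_add)
  have du: "fps_deriv u = - c" by (simp add: u_def c_def)
  have h1: "u * fps_deriv A = - (q * c * A)"
    using A by (simp add: u_def pq)
  have "fps_deriv (u * fps_deriv A) = fps_deriv (- (q * c * A))" by (simp only: h1)
  then have h2: "u * fps_deriv (fps_deriv A) = c * fps_deriv A - q * c * fps_deriv A"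
  proof -
    have "fps_deriv (u * fps_deriv A) = u * fps_deriv (fps_deriv A) - c * fps_deriv A"
      unfolding fps_deriv_mult du by (simp only: algebra_simps) simp
    moreover have "fps_deriv (- (q * c * A)) = - (q * c * fps_deriv A)"
      by (simp add: q_def c_def)
    ultimately show ?thesis
      using \<open>fps_deriv (u * fps_deriv A) = fps_deriv (- (q * c * A))\<close> by (simp only:) algebra
  qed
  have g1: "u * fps_deriv F + q * c * F = u * A * fps_deriv Y"
    using h1 unfolding F_def fps_deriv_mult by algebra
  have g2: "u\<^sup>2 * fps_deriv (fps_deriv F) + 2 * (q * c) * u * fps_deriv F + q * (q + 1) * c\<^sup>2 * F
      = u\<^sup>2 * A * fps_deriv (fps_deriv Y)"
    using h1 h2 unfolding F_def fps_deriv_mult fps_deriv_add by algebra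
  show ?thesis
    unfolding pq g2
    using g1 Y unfolding F_def by algebra
qed

section \<open>From the differential equation to the recurrence\<close>

text \<open>
  Comparison of the coefficients of \<open>X\<^sup>0\<close>, \<open>X\<^sup>1\<close> and \<open>X\<^sup>n\<^sup>+\<^sup>2\<close>.  All three conclusions are the same relation
  \<open>(k + 1) (k + 1/2) F\<^sub>k\<^sub>+\<^sub>1 = \<mu>\<^sub>k F\<^sub>k - \<theta> \<zeta>\<^sub>k F\<^sub>k\<^sub>-\<^sub>1 + \<theta>\<^sup>2 \<sigma>\<^sub>k F\<^sub>k\<^sub>-\<^sub>2\<close>, where coefficients of negative
  index count as zero.
\<close>

lemma twisted_recurrence:
  fixes F :: "complex fps"
  assumes ODE: "2 * fps_X * (1 - fps_X) * ((1 - fps_const \<theta> * fps_X)\<^sup>2 * fps_deriv (fps_deriv F)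
             + 2 * fps_const (p * \<theta>) * (1 - fps_const \<theta> * fps_X) * fps_deriv F
             + fps_const (p * (p + 1) * \<theta>\<^sup>2) * F)
         + (1 - 2 * fps_X) * ((1 - fps_const \<theta> * fps_X)\<^sup>2 * fps_deriv F
             + fps_const (p * \<theta>) * (1 - fps_const \<theta> * fps_X) * F)
         + 2 * fps_const ((of_nat m)\<^sup>2) * (1 - fps_const \<theta> * fps_X)\<^sup>2 * F = 0"
    (is "?L = 0")
  shows "F $ 1 = 2 * rec_mu m \<theta> p 0 * F $ 0"
    and "3 * F $ 2 = rec_mu m \<theta> p 1 * F $ 1 - \<theta> * rec_zeta m \<theta> p 1 * F $ 0"
    and "(of_nat (n + 3)) * (of_nat (n + 2) + 1/2) * F $ (n + 3) = rec_mu m \<theta> p (n + 2) * F $ (n + 2)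
           - \<theta> * rec_zeta m \<theta> p (n + 2) * F $ (n + 1) + \<theta>\<^sup>2 * rec_sigma m p (n + 2) * F $ n"
proof -
  define H where "H = fps_deriv F"
  define G where "G = fps_deriv H"
  define M where "M = (of_nat m :: complex)\<^sup>2"
  \<comment> \<open>The left-hand side, sorted by the powers of \<open>X\<close> that multiply \<open>F''\<close>, \<open>F'\<close> and \<open>F\<close>.\<close>
  define R where "R = fps_const 2 * (fps_X ^ 1 * G) - fps_const (2 + 4 * \<theta>) * (fps_X ^ 2 * G)
      + fps_const (4 * \<theta> + 2 * \<theta>\<^sup>2) * (fps_X ^ 3 * G) - fps_const (2 * \<theta>\<^sup>2) * (fps_X ^ 4 * G)
      + H + fps_const (4 * p * \<theta> - 2 - 2 * \<theta>) * (fps_X ^ 1 * H)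
      + fps_const (4 * \<theta> + \<theta>\<^sup>2 - 4 * p * \<theta> * (1 + \<theta>)) * (fps_X ^ 2 * H)
      + fps_const (4 * p * \<theta>\<^sup>2 - 2 * \<theta>\<^sup>2) * (fps_X ^ 3 * H)
      + fps_const (p * \<theta> + 2 * M) * F
      + fps_const (2 * p * (p + 1) * \<theta>\<^sup>2 - p * \<theta> * (2 + \<theta>) - 4 * M * \<theta>) * (fps_X ^ 1 * F)
      + fps_const (2 * p * \<theta>\<^sup>2 - 2 * p * (p + 1) * \<theta>\<^sup>2 + 2 * M * \<theta>\<^sup>2) * (fps_X ^ 2 * F)"
  have "?L = R"
    unfolding R_def H_def[symmetric] G_def[symmetric] M_def[symmetric]
      fps_const_mult[symmetric] fps_const_add[symmetric] fps_const_sub[symmetric]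
      fps_const_power[symmetric] fps_const_1_eq_1 numeral_fps_const[symmetric]
    by algebra
  then have nth: "R $ k = 0" for k using ODE by simp
  have H: "H $ k = of_nat (k + 1) * F $ (k + 1)" for k by (simp add: H_def)
  have G: "G $ k = of_nat (k + 1) * of_nat (k + 2) * F $ (k + 2)" for k by (simp add: G_def H)
  have two: "Suc (Suc 0) = 2" by simp
  show "F $ 1 = 2 * rec_mu m \<theta> p 0 * F $ 0"
    using nth[of 0] by (simp add: R_def H fps_X_power_mult_nth M_def rec_mu_def) algebra
  show "3 * F $ 2 = rec_mu m \<theta> p 1 * F $ 1 - \<theta> * rec_zeta m \<theta> p 1 * F $ 0"
    using nth[of 1] by (simp add: R_def two G H fps_X_power_mult_nth M_def rec_mu_def rec_zeta_def) algebra
  \<comment> \<open>For \<open>n < 2\<close> the higher powers of \<open>X\<close> reach below the constant coefficient, and the factors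
     \<open>n\<close> and \<open>n - 1\<close> on the right vanish accordingly.\<close>
  have GX: "(fps_X ^ 1 * G) $ (n + 2) = of_nat (n + 2) * of_nat (n + 3) * F $ (n + 3)"
    "(fps_X ^ 2 * G) $ (n + 2) = of_nat (n + 1) * of_nat (n + 2) * F $ (n + 2)"
    "(fps_X ^ 3 * G) $ (n + 2) = of_nat n * of_nat (n + 1) * F $ (n + 1)"
    "(fps_X ^ 4 * G) $ (n + 2) = (of_nat n - 1) * of_nat n * F $ n"
    unfolding fps_X_power_mult_nth
    by (cases n; cases "n - 1"; simp add: G numeral_eq_Suc algebra_simps)+
  have HX: "H $ (n + 2) = of_nat (n + 3) * F $ (n + 3)"
    "(fps_X ^ 1 * H) $ (n + 2) = of_nat (n + 2) * F $ (n + 2)"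
    "(fps_X ^ 2 * H) $ (n + 2) = of_nat (n + 1) * F $ (n + 1)"
    "(fps_X ^ 3 * H) $ (n + 2) = of_nat n * F $ n"
    unfolding fps_X_power_mult_nth
    by (cases n; simp add: H numeral_eq_Suc)+
  have FX: "(fps_X ^ 1 * F) $ (n + 2) = F $ (n + 1)" "(fps_X ^ 2 * F) $ (n + 2) = F $ n"
    unfolding fps_X_power_mult_nth by simp_all
  show "(of_nat (n + 3)) * (of_nat (n + 2) + 1/2) * F $ (n + 3) = rec_mu m \<theta> p (n + 2) * F $ (n + 2)
           - \<theta> * rec_zeta m \<theta> p (n + 2) * F $ (n + 1) + \<theta>\<^sup>2 * rec_sigma m p (n + 2) * F $ n"
    using nth[of "n + 2"]
    unfolding R_def fps_add_nth fps_sub_nth fps_mult_left_const_nth GX HX FX M_def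
      rec_mu_def rec_zeta_def rec_sigma_def of_nat_add of_nat_numeral of_nat_1
    by algebra
qed

section \<open>Convergence and analytic continuation\<close>

lemma has_fps_expansion_binomial_scaled:
  "(\<lambda>w. (1 - \<theta> * w) powr p) has_fps_expansion binomial_scaled \<theta> p"
proof (rule has_fps_expansionI)
  have "open {w. norm (\<theta> * w) < 1}"
    by (intro open_Collect_less continuous_intros)
  from eventually_nhds_in_open[OF this, of 0]
  have "eventually (\<lambda>w. norm (\<theta> * w) < 1) (nhds 0)" by simp
  then show "eventually (\<lambda>w. (\<lambda>n. binomial_scaled \<theta> p $ n * w ^ n) sums (1 - \<theta> * w) powr p) (nhds 0)"
  proof eventually_elim
    case (elim w)
    then show ?case
      using gen_binomial_complex[of "- (\<theta> * w)" p]
      by (simp add: binomial_scaled_def mult.assoc flip: power_mult_distrib)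
  qed
qed

definition twisted_chebyshev :: "nat \<Rightarrow> complex \<Rightarrow> complex \<Rightarrow> complex \<Rightarrow> complex" where
  "twisted_chebyshev m \<theta> p w = (1 - \<theta> * w) powr p * poly (chebyshev_T m) (1 - 2 * w)"

lemma has_fps_expansion_twisted_chebyshev:
  "twisted_chebyshev m \<theta> p has_fps_expansion binomial_scaled \<theta> p * chebyshev_shifted m"
proof -
  have "eval_fps (chebyshev_shifted m) has_fps_expansion chebyshev_shifted m"
    by (rule eval_fps_has_fps_expansion) (simp add: chebyshev_shifted_def)
  also have "eval_fps (chebyshev_shifted m) = (\<lambda>w. poly (chebyshev_T m) (1 - 2 * w))"
    by (simp add: chebyshev_shifted_def poly_pcompose fun_eq_iff mult.commute)
  finally show ?thesis
    unfolding twisted_chebyshev_def[abs_def]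
    by (intro has_fps_expansion_mult has_fps_expansion_binomial_scaled)
qed

lemma twisted_chebyshev_holomorphic:
  assumes "\<And>w. w \<in> S \<Longrightarrow> 1 - \<theta> * w \<notin> \<real>\<^sub>\<le>\<^sub>0"
  shows "twisted_chebyshev m \<theta> p holomorphic_on S"
  unfolding twisted_chebyshev_def[abs_def] using assms by (intro holomorphic_intros) auto

lemma sums_twisted_chebyshev:
  assumes F: "twisted_chebyshev m \<theta> p has_fps_expansion F" and x: "norm (\<theta> * x) < 1"
  shows "(\<lambda>n. F $ n * x ^ n) sums twisted_chebyshev m \<theta> p x"
proof -
  obtain r where r: "norm x < r" "norm \<theta> * r < 1"
  proof (cases "\<theta> = 0")
    case True
    then show ?thesis using that[of "norm x + 1"] by simp
  next
    case False
    then have "norm x < 1 / norm \<theta>" using x by (simp add: norm_mult field_simps)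
    then obtain r where "norm x < r" "r < 1 / norm \<theta>" using dense by blast
    then show ?thesis using that[of r] False by (simp add: field_simps)
  qed
  have hol: "twisted_chebyshev m \<theta> p holomorphic_on ball 0 r"
  proof (rule twisted_chebyshev_holomorphic)
    fix w :: complex assume "w \<in> ball 0 r"
    then have "norm (\<theta> * w) \<le> norm \<theta> * r" by (simp add: norm_mult mult_left_mono)
    with r have "norm (\<theta> * w) < 1" by linarith
    then have "Re (\<theta> * w) < 1" using complex_Re_le_cmod[of "\<theta> * w"] by linarith
    then show "1 - \<theta> * w \<notin> \<real>\<^sub>\<le>\<^sub>0" by (auto simp: complex_nonpos_Reals_iff)
  qed
  show ?thesis
    using holomorphic_power_series[OF hol, of x] r(1)
    by (simp add: fps_nth_fps_expansion[OF F])
qed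

text \<open>
  For a natural exponent \<open>(1 - \<theta> w)\<^sup>p\<close> extends to a polynomial, so \<open>F\<close> is the Taylor series of an entire
  function.  At \<open>1 - \<theta> x = 0\<close> the extension need not agree with the complex power, since \<open>0 powr 0 = 0\<close>.
\<close>

lemma sums_twisted_chebyshev_nat:
  assumes F: "twisted_chebyshev m \<theta> p has_fps_expansion F" and p: "p \<in> \<nat>" and x: "1 - \<theta> * x \<noteq> 0"
  shows "(\<lambda>n. F $ n * x ^ n) sums twisted_chebyshev m \<theta> p x"
proof -
  from p obtain k where k: "p = of_nat k" by (auto elim: Nats_cases)
  define g where "g = (\<lambda>w. (1 - \<theta> * w) ^ k * poly (chebyshev_T m) (1 - 2 * w))"
  have eq: "twisted_chebyshev m \<theta> p w = g w" if "1 - \<theta> * w \<noteq> 0" for w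
    using that by (simp add: twisted_chebyshev_def g_def k powr_nat')
  have "open {w. 1 - \<theta> * w \<noteq> 0}"
    by (intro open_Collect_neq continuous_intros)
  from eventually_nhds_in_open[OF this, of 0]
  have "eventually (\<lambda>w. 1 - \<theta> * w \<noteq> 0) (nhds 0)" by simp
  then have "eventually (\<lambda>w. twisted_chebyshev m \<theta> p w = g w) (nhds 0)"
    by eventually_elim (rule eq)
  then have gF: "g has_fps_expansion F"
    using F has_fps_expansion_cong by blast
  have "g holomorphic_on ball 0 (norm x + 1)"
    unfolding g_def by (intro holomorphic_intros)
  from holomorphic_power_series[OF this, of x] show ?thesis
    by (simp add: fps_nth_fps_expansion[OF gF] eq[OF x])
qed

text \<open>
  Convergence at \<open>x\<close> makes the sum of \<open>F\<close> holomorphic on the disc of radius \<open>\<bar>x\<bar>\<close>, but this disc may contain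
  the point \<open>1 / \<theta>\<close>, where the branch cut of the principal power begins.  Removing the points where \<open>1 - \<theta> w\<close> meets the branch cut leaves a domain that is
  star-shaped about the origin, hence connected, so the two holomorphic functions agree on all of it.
  It contains \<open>r x\<close> for \<open>0 \<le> r < 1\<close>, and the limit \<open>r \<rightarrow> 1\<close> exists on both sides.
\<close>

lemma suminf_twisted_chebyshev:
  assumes F: "twisted_chebyshev m \<theta> p has_fps_expansion F"
    and slit: "1 - \<theta> * x \<notin> \<real>\<^sub>\<le>\<^sub>0" and sum: "summable (\<lambda>n. F $ n * x ^ n)"
  shows "twisted_chebyshev m \<theta> p x = (\<Sum>n. F $ n * x ^ n)"
proof (cases "x = 0")
  case True
  then have "norm (\<theta> * x) < 1" by simp
  from sums_twisted_chebyshev[OF F this] show ?thesis by (simp add: sums_iff)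
next
  case False
  define f where "f = twisted_chebyshev m \<theta> p"
  define S where "S = ball 0 (norm x) \<inter> {w. 1 - \<theta> * w \<notin> \<real>\<^sub>\<le>\<^sub>0}"
  \<comment> \<open>If \<open>1 - r t\<close> is on the cut then \<open>r t \<ge> 1\<close> is real, hence so is \<open>t \<ge> r t\<close>.\<close>
  have shrink: "1 - \<theta> * (of_real r * w) \<notin> \<real>\<^sub>\<le>\<^sub>0"
    if "0 \<le> r" "r \<le> 1" "1 - \<theta> * w \<notin> \<real>\<^sub>\<le>\<^sub>0" for r :: real and w
  proof
    assume "1 - \<theta> * (of_real r * w) \<in> \<real>\<^sub>\<le>\<^sub>0"
    then have "r * Re (\<theta> * w) \<ge> 1" "r * Im (\<theta> * w) = 0"
      by (auto simp: complex_nonpos_Reals_iff algebra_simps)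
    moreover from this that have "r * Re (\<theta> * w) \<le> Re (\<theta> * w)"
      by (smt (verit) mult_left_le_one_le mult_nonneg_nonpos)
    ultimately have "Re (\<theta> * w) \<ge> 1" "Im (\<theta> * w) = 0" by auto
    with that(3) show False by (simp add: complex_nonpos_Reals_iff)
  qed
  have "open S"
    unfolding S_def
  proof (intro open_Int open_ball)
    have "closed ((\<lambda>w. 1 - \<theta> * w) -` \<real>\<^sub>\<le>\<^sub>0)"
      by (intro closed_vimage closed_nonpos_Reals_complex continuous_intros)
    then show "open {w. 1 - \<theta> * w \<notin> \<real>\<^sub>\<le>\<^sub>0}"
      by (simp add: closed_def vimage_def Collect_neg_eq[symmetric])
  qed
  have "0 \<in> S" using False by (simp add: S_def)
  have "connected S"
  proof (rule starlike_imp_connected)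
    have "closed_segment 0 w \<subseteq> S" if "w \<in> S" for w
    proof
      fix y assume "y \<in> closed_segment 0 w"
      then obtain r :: real where r: "0 \<le> r" "r \<le> 1" "y = of_real r * w"
        by (auto simp: in_segment scaleR_conv_of_real)
      have "norm y \<le> norm w" using r by (simp add: norm_mult mult_left_le_one_le)
      then show "y \<in> S" using that shrink[OF r(1,2)] r(3) by (auto simp: S_def)
    qed
    then show "starlike S" using \<open>0 \<in> S\<close> by (auto simp: starlike_def)
  qed
  have rad: "ereal (norm x) \<le> fps_conv_radius F"
    unfolding fps_conv_radius_def by (rule conv_radius_geI[OF sum])
  have cont: "eval_fps F w = f w" if "w \<in> S" for w
  proof -
    have "eventually (\<lambda>w. eval_fps F w = f w) (nhds 0)"
      using F by (simp add: has_fps_expansion_def f_def)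
    then obtain U where U: "open U" "0 \<in> U" "\<And>w. w \<in> U \<Longrightarrow> eval_fps F w = f w"
      by (auto simp: eventually_nhds)
    show ?thesis
    proof (rule analytic_continuation_open[of "U \<inter> S" S "eval_fps F" f w])
      show "eval_fps F holomorphic_on S"
      proof (rule holomorphic_on_eval_fps)
        have "ereal (norm w) < fps_conv_radius F" if "w \<in> S" for w
        proof (rule order_less_le_trans[OF _ rad])
          show "ereal (norm w) < ereal (norm x)" using that by (simp add: S_def)
        qed
        then show "S \<subseteq> eball 0 (fps_conv_radius F)" by auto
      qed
      show "f holomorphic_on S"
        unfolding f_def by (rule twisted_chebyshev_holomorphic) (simp add: S_def)
    qed (use U \<open>open S\<close> \<open>0 \<in> S\<close> \<open>connected S\<close> that in auto)
  qed
  have "((\<lambda>r. \<Sum>n. F $ n * x ^ n * of_real r ^ n) \<longlongrightarrow> (\<Sum>n. F $ n * x ^ n)) (at_left 1)"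
    by (rule Abel_limit[OF summable_sums[OF sum]])
  moreover have "((\<lambda>r. \<Sum>n. F $ n * x ^ n * of_real r ^ n) \<longlongrightarrow> f x) (at_left 1)"
  proof (rule Lim_transform_eventually)
    have "isCont f x"
      unfolding f_def twisted_chebyshev_def[abs_def] using slit by (intro continuous_intros) auto
    moreover have "((\<lambda>r::real. of_real r * x) \<longlongrightarrow> of_real 1 * x) (at_left 1)"
      by (intro tendsto_intros)
    ultimately show "((\<lambda>r. f (of_real r * x)) \<longlongrightarrow> f x) (at_left 1)"
      using isCont_tendsto_compose by fastforce
    show "eventually (\<lambda>r. f (of_real r * x) = (\<Sum>n. F $ n * x ^ n * of_real r ^ n)) (at_left 1)"
      using eventually_at_left_real[of 0 1, simplified]
    proof eventually_elim
      case (elim r)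
      then have "of_real r * x \<in> S"
        using shrink[of r x] slit False by (auto simp: S_def norm_mult)
      from cont[OF this] show ?case
        by (simp add: eval_fps_def power_mult_distrib mult_ac)
    qed
  qed
  ultimately show ?thesis
    unfolding f_def by (rule tendsto_unique[OF trivial_limit_at_left_real, symmetric])
qed

theorem corollary4p10:
  fixes m :: nat and z \<theta> p :: complex and v :: "nat \<Rightarrow> complex"
  assumes z: "cmod ((1 - z) / 2) < 1"
    and nonzero: "1 - \<theta> * ((1 - z) / 2) \<noteq> 0"
    and arg: "\<bar>Arg (1 - \<theta> * ((1 - z) / 2))\<bar> < pi"
    and v0: "v 0 = 1"
    and v1: "v 1 = - 2 * (of_nat m)^2 - p * \<theta>"
    and v2: "v 2 = 1/2 * \<theta>^2 * p * (p - 1) + 2 * (of_nat m)^2 * \<theta> * p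
                   + 4 * (of_nat m)^2 * (of_nat m + 1) * (of_nat m - 1) / 6"
    and v_rec: "\<And>n. n \<ge> 2 \<Longrightarrow>
          v (n + 1) = rec_mu m \<theta> p n / ((of_nat n + 1) * (of_nat n + 1/2)) * v n
                      - \<theta> * (rec_zeta m \<theta> p n / ((of_nat n + 1) * (of_nat n + 1/2))) * v (n - 1)
                      + \<theta>^2 * (rec_sigma m p n / ((of_nat n + 1) * (of_nat n + 1/2))) * v (n - 2)"
  shows "(cmod (\<theta> * ((1 - z) / 2)) < 1 \<or> p \<in> \<nat> \<longrightarrow>
            (\<lambda>n. v n * ((1 - z) / 2) ^ n) sums
              ((1 - \<theta> * ((1 - z) / 2)) powr p * poly (chebyshev_T m) z))
       \<and> (summable (\<lambda>n. v n * ((1 - z) / 2) ^ n) \<longrightarrow>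
            (1 - \<theta> * ((1 - z) / 2)) powr p * poly (chebyshev_T m) z
              = (\<Sum>n. v n * ((1 - z) / 2) ^ n))"
proof -
  define x where "x = (1 - z) / 2"
  define F where "F = binomial_scaled \<theta> p * chebyshev_shifted m"
  have F: "twisted_chebyshev m \<theta> p has_fps_expansion F"
    unfolding F_def by (rule has_fps_expansion_twisted_chebyshev)
  note rec = twisted_recurrence[OF twisted_ODE[OF binomial_scaled_ODE[of \<theta> p] chebyshev_shifted_ODE[of m]],
      folded F_def]
  have F0: "F $ 0 = 1"
    by (simp add: F_def binomial_scaled_def chebyshev_shifted_def poly_0_coeff_0[symmetric]
        poly_pcompose chebyshev_T_at_1)
  have F1: "F $ 1 = - 2 * (of_nat m)^2 - p * \<theta>"
    using rec(1) F0 by (simp add: rec_mu_def power2_eq_square algebra_simps)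
  have F2: "F $ 2 = 1/2 * \<theta>^2 * p * (p - 1) + 2 * (of_nat m)^2 * \<theta> * p
                   + 4 * (of_nat m)^2 * (of_nat m + 1) * (of_nat m - 1) / 6"
  proof -
    have "3 * F $ 2 = 3 * (1/2 * \<theta>^2 * p * (p - 1) + 2 * (of_nat m)^2 * \<theta> * p
                   + 4 * (of_nat m)^2 * (of_nat m + 1) * (of_nat m - 1) / 6)"
      unfolding rec(2) F0 F1 rec_mu_def rec_zeta_def by (simp add: field_simps) algebra
    then show ?thesis by (subst (asm) mult_cancel_left) simp
  qed
  have vF: "v n = F $ n" for n
  proof (induction n rule: less_induct)
    case (less n)
    consider "n = 0" | "n = 1" | "n = 2" | k where "n = k + 3"
      by (metis One_nat_def add.commute add_2_eq_Suc' numeral_3_eq_3 not0_implies_Suc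
          numeral_2_eq_2 add_Suc_right add_0_right)
    then show ?case
    proof cases
      case (4 k)
      have half: "(of_nat (k + 2) + 1/2 :: complex) \<noteq> 0"
      proof -
        have "of_nat (k + 2) + 1/2 = (of_real (real (k + 2) + 1/2) :: complex)" by simp
        then show ?thesis by (simp only: of_real_eq_0_iff)
      qed
      have nz: "(of_nat (k + 3) :: complex) \<noteq> 0" by (simp only: of_nat_eq_0_iff)
      have "of_nat (k + 2) + 1 = (of_nat (k + 3) :: complex)" by simp
      then have "v (k + 3) = (rec_mu m \<theta> p (k + 2) * v (k + 2) - \<theta> * rec_zeta m \<theta> p (k + 2) * v (k + 1)
          + \<theta>\<^sup>2 * rec_sigma m p (k + 2) * v k) / (of_nat (k + 3) * (of_nat (k + 2) + 1/2))"
        using v_rec[of "k + 2"] by (simp add: diff_divide_distrib add_divide_distrib numeral_eq_Suc)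
      also have "\<dots> = F $ (k + 3)"
      proof -
        have "v (k + 2) = F $ (k + 2)" "v (k + 1) = F $ (k + 1)" "v k = F $ k"
          using less[of "k + 2"] less[of "k + 1"] less[of k] 4 by auto
        then show ?thesis
          using half nz by (simp only: rec(3)[symmetric]) simp
      qed
      finally show ?thesis using 4 by simp
    qed (use v0 v1 v2 F0 F1 F2 in simp_all)
  qed
  have f: "twisted_chebyshev m \<theta> p x = (1 - \<theta> * x) powr p * poly (chebyshev_T m) z"
  proof -
    have "1 - 2 * x = z" by (simp add: x_def field_simps)
    then show ?thesis by (simp only: twisted_chebyshev_def)
  qed
  have nz: "1 - \<theta> * x \<noteq> 0" using nonzero by (simp add: x_def)
  have "1 - \<theta> * x \<notin> \<real>\<^sub>\<le>\<^sub>0"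
  proof
    assume "1 - \<theta> * x \<in> \<real>\<^sub>\<le>\<^sub>0"
    with nz have "Arg (1 - \<theta> * x) = pi"
      by (auto simp: Arg_eq_pi complex_nonpos_Reals_iff complex_eq_iff)
    with arg show False by (simp add: x_def)
  qed
  from sums_twisted_chebyshev[OF F, of x] sums_twisted_chebyshev_nat[OF F _ nz]
    suminf_twisted_chebyshev[OF F this]
  show ?thesis
    unfolding vF f x_def[symmetric] by blast
qed

end
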